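(* Let $\Omega:=\mathbb C\setminus[1,\infty)$ and let $s\in\mathbb C$ with $\Re(s)>1$. The function $\log G_s(z)=\sum_{r=2}^{\infty}\frac{\zeta(r)}{r^s}z^r$ ($|z|<1$) extends holomorphically to $\Omega$, and, denoting the extension again by $\log G_s$, for all $z\in\Omega$ $$\log G_s(z)=\frac1{\Gamma(s-1)}\int_0^z\frac{\log\Gamma(1-w)-\gamma w}{w}\left(\log\frac zw\right)^{s-2}\,dw,$$ where the integral is taken along the line segment joining $0$ and $z$.
   Context: $\zeta$ is the Riemann zeta function, $\gamma$ is Euler's constant, $\Gamma$ is the gamma function. For $s\in\mathbb C$ and $|z|<1$ the polylogarithmic gamma function is $$G_s(z):=\exp\left(\sum_{r=2}^{\infty}\frac{\zeta(r)}{r^s}z^r\right),$$ and $\log G_s(z)$ denotes the series in the exponent. On the simply connected domain $\Omega$, $\log\Gamma(1-w)$ denotes the holomorphic branch of the logarithm of $\Gamma(1-w)$ that vanishes at $w=0$; the quotient $(\log\Gamma(1-w)-\gamma w)/w$ is extended holomorphically to $w=0$. On the segment from $0$ to $z\neq0$ the ratio $z/w$ is real and $\ge1$, $\log(z/w)$ is the real logarithm, and for $x>0$, $x^{s-2}=e^{(s-2)\log x}$. For $z=0$ the integral is taken to be $0$. *)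

theory Defs
  imports "HOL-Complex_Analysis.Complex_Analysis"
begin

text \<open>The Riemann zeta function on the half-plane of absolute convergence \<open>Re s > 1\<close>, where it is
  given by its Dirichlet series. (The definition carries no meaning for other \<open>s\<close>.)\<close>

definition zeta :: "complex \<Rightarrow> complex" where
  "zeta s = (\<Sum>n. 1 / of_nat (Suc n) powr s)"

lemma zeta_sums:
  assumes "Re s > 1"
  shows   "(\<lambda>n. 1 / of_nat (Suc n) powr s) sums zeta s"
proof -
  have "summable (\<lambda>n. real n powr (- Re s))"
    using assms by (subst summable_real_powr_iff) auto
  hence "summable (\<lambda>n. real (Suc n) powr (- Re s))"
    by (subst summable_Suc_iff)
  also have "(\<lambda>n. real (Suc n) powr (- Re s)) = (\<lambda>n. norm (1 / of_nat (Suc n) powr s :: complex))"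
  proof
    fix n
    have "norm (of_real (real (Suc n)) powr s :: complex) = real (Suc n) powr Re s"
      by (subst norm_powr_real_powr) auto
    thus "real (Suc n) powr (- Re s) = norm (1 / of_nat (Suc n) powr s :: complex)"
      by (simp add: norm_divide powr_minus field_simps del: of_nat_Suc)
  qed
  finally show ?thesis
    unfolding zeta_def by (rule summable_sums[OF summable_norm_cancel])
qed

text \<open>\<open>log_polylog_Gamma s z\<close> is the series written \<open>log G\<^sub>s(z)\<close>, summed from \<open>r = 2\<close> by an index
  shift; it is meaningful for \<open>\<bar>z\<bar> < 1\<close>.\<close>

definition log_polylog_Gamma :: "complex \<Rightarrow> complex \<Rightarrow> complex" where
  "log_polylog_Gamma s z = (\<Sum>k. zeta (of_nat (k + 2)) / of_nat (k + 2) powr s * z ^ (k + 2))"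

definition polylog_Gamma :: "complex \<Rightarrow> complex \<Rightarrow> complex" where
  "polylog_Gamma s z = exp (log_polylog_Gamma s z)"

definition slit_plane :: "complex set" where
  "slit_plane = UNIV - complex_of_real ` {1..}"

lemma open_slit_plane: "open slit_plane"
proof -
  have "closed (complex_of_real ` {1..})"
    by (intro closed_injective_linear_image) (auto simp: inj_on_def bounded_linear.linear[OF bounded_linear_of_real])
  thus ?thesis unfolding slit_plane_def by (simp add: open_Diff)
qed

lemma connected_slit_plane: "connected slit_plane"
proof -
  have "starlike slit_plane"
    unfolding starlike_def
  proof (intro bexI ballI subsetI)
    show "0 \<in> slit_plane" by (auto simp: slit_plane_def)
    fix x w assume x: "x \<in> slit_plane" and "w \<in> closed_segment 0 x"
    then obtain u where u: "0 \<le> u" "u \<le> 1" "w = of_real u * x"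
      by (auto simp: closed_segment_def scaleR_conv_of_real)
    show "w \<in> slit_plane"
    proof (rule ccontr)
      assume "w \<notin> slit_plane"
      then obtain t where t: "t \<ge> 1" "of_real u * x = of_real t"
        using u by (auto simp: slit_plane_def)
      hence "u > 0" using u by (cases "u = 0") auto
      hence "x = of_real (t / u)" using t by (simp add: field_simps)
      moreover have "t / u \<ge> 1" using t u \<open>u > 0\<close> by (simp add: field_simps)
      ultimately show False using x unfolding slit_plane_def by blast
    qed
  qed
  thus ?thesis by (rule starlike_imp_connected)
qed

text \<open>The branch of \<open>log \<Gamma>(1 - w)\<close> on the slit plane that vanishes at \<open>0\<close> is the library's
  \<^const>\<open>ln_Gamma\<close> at \<open>1 - w\<close>.\<close>

lemma one_minus_slit_plane: "w \<in> slit_plane \<Longrightarrow> 1 - w \<notin> \<real>\<^sub>\<le>\<^sub>0"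
proof
  assume w: "w \<in> slit_plane" and "1 - w \<in> \<real>\<^sub>\<le>\<^sub>0"
  then obtain x where "x \<le> 0" "1 - w = of_real x"
    by (auto elim!: nonpos_Reals_cases)
  hence "w = of_real (1 - x)" "1 - x \<ge> 1" by (auto simp: algebra_simps)
  thus False using w unfolding slit_plane_def by blast
qed

lemma ln_Gamma_complex_1: "ln_Gamma (1 :: complex) = 0"
proof -
  have "exp (ln_Gamma (1 :: real)) = 1"
    using Gamma_real_pos_exp[of 1] by simp
  thus ?thesis
    using ln_Gamma_complex_of_real[of 1] by simp
qed

lemma holomorphic_ln_Gamma_one_minus: "(\<lambda>w. ln_Gamma (1 - w)) holomorphic_on slit_plane"
proof -
  have "((\<lambda>w. ln_Gamma (1 - w)) has_field_derivative (- Digamma (1 - w))) (at w)"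
    if "w \<in> slit_plane" for w
    using one_minus_slit_plane[OF that] by (auto intro!: derivative_eq_intros)
  thus ?thesis using open_slit_plane by (auto simp: holomorphic_on_open)
qed

lemma exp_ln_Gamma_one_minus: "w \<in> slit_plane \<Longrightarrow> exp (ln_Gamma (1 - w)) = Gamma (1 - w)"
  using one_minus_slit_plane[of w] nonpos_Ints_subset_nonpos_Reals
  by (subst Gamma_complex_altdef) auto

lemma ln_Gamma_one_minus_unique:
  assumes L: "L holomorphic_on slit_plane" "L 0 = 0"
    and "\<And>w. w \<in> slit_plane \<Longrightarrow> exp (L w) = Gamma (1 - w)"
    and w: "w \<in> slit_plane"
  shows "L w = ln_Gamma (1 - w)"
proof -
  have 0: "0 \<in> slit_plane" by (auto simp: slit_plane_def)
  have exp1: "exp (L v - ln_Gamma (1 - v)) = 1" if "v \<in> slit_plane" for v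
    using assms(3)[OF that] exp_ln_Gamma_one_minus[OF that]
    by (metis exp_diff exp_not_eq_zero divide_self)
  have "(\<lambda>v. L v - ln_Gamma (1 - v)) constant_on slit_plane"
  proof (rule continuous_discrete_range_constant[OF connected_slit_plane])
    show "continuous_on slit_plane (\<lambda>v. L v - ln_Gamma (1 - v))"
      by (intro continuous_intros holomorphic_on_imp_continuous_on L holomorphic_ln_Gamma_one_minus)
    fix v assume v: "v \<in> slit_plane"
    have "1 \<le> norm (L y - ln_Gamma (1 - y) - (L v - ln_Gamma (1 - v)))"
      if y: "y \<in> slit_plane" and ne: "L y - ln_Gamma (1 - y) \<noteq> L v - ln_Gamma (1 - v)" for y
    proof -
      define d where "d = L y - ln_Gamma (1 - y) - (L v - ln_Gamma (1 - v))"
      have "exp d = 1" using exp1[OF y] exp1[OF v] by (simp add: d_def exp_diff)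
      then obtain n :: int where n: "Re d = 0" "Im d = of_int (2 * n) * pi"
        by (auto simp: exp_eq_1)
      have "d \<noteq> 0" using ne by (simp add: d_def)
      hence "n \<noteq> 0" using n by (auto simp: complex_eq_iff)
      hence "1 \<le> \<bar>real_of_int (2 * n)\<bar>" by linarith
      also have "\<dots> \<le> \<bar>real_of_int (2 * n)\<bar> * pi" using pi_ge_two by (intro mult_le_cancel_left1[THEN iffD2]) auto
      also have "\<dots> = \<bar>Im d\<bar>" using n by (simp add: abs_mult)
      also have "\<dots> \<le> norm d" by (rule abs_Im_le_cmod)
      finally show ?thesis by (simp add: d_def)
    qed
    thus "\<exists>e>0. \<forall>y. y \<in> slit_plane \<and> L y - ln_Gamma (1 - y) \<noteq> L v - ln_Gamma (1 - v)
            \<longrightarrow> e \<le> norm (L y - ln_Gamma (1 - y) - (L v - ln_Gamma (1 - v)))"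
      by (intro exI[of _ 1]) auto
  qed
  then obtain c where c: "\<And>v. v \<in> slit_plane \<Longrightarrow> L v - ln_Gamma (1 - v) = c"
    by (auto simp: constant_on_def)
  have "c = 0" using c[OF 0] L(2) by (simp add: ln_Gamma_complex_1)
  thus ?thesis using c[OF w] by simp
qed

text \<open>The quotient \<open>(log \<Gamma>(1 - w) - \<gamma> w) / w\<close>, whose holomorphic extension has the value \<open>0\<close> at
  \<open>w = 0\<close> because \<open>\<Gamma>'(1) = -\<gamma>\<close>.\<close>

definition ln_Gamma_quot :: "complex \<Rightarrow> complex" where
  "ln_Gamma_quot w = (if w = 0 then 0 else (ln_Gamma (1 - w) - euler_mascheroni * w) / w)"

lemma holomorphic_ln_Gamma_quot: "ln_Gamma_quot holomorphic_on slit_plane"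
proof -
  define f where "f = (\<lambda>w::complex. ln_Gamma (1 - w) - euler_mascheroni * w)"
  have "f holomorphic_on slit_plane"
    unfolding f_def by (intro holomorphic_intros holomorphic_ln_Gamma_one_minus)
  moreover have "0 \<in> interior slit_plane"
    using open_slit_plane by (simp add: interior_open) (auto simp: slit_plane_def)
  ultimately have "(\<lambda>w. if w = 0 then deriv f 0 else (f w - f 0) / (w - 0)) holomorphic_on slit_plane"
    by (rule pole_lemma)
  moreover have "(f has_field_derivative 0) (at 0)"
    unfolding f_def by (auto intro!: derivative_eq_intros)
  hence "deriv f 0 = 0" by (rule DERIV_imp_deriv)
  moreover have "f 0 = 0" by (simp add: f_def ln_Gamma_complex_1)
  ultimately show ?thesis
    by (auto simp: f_def ln_Gamma_quot_def[abs_def] cong: if_cong)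
qed

text \<open>The integrand. On the segment from \<open>0\<close> to \<open>z \<noteq> 0\<close> the quotient \<open>z / w\<close> is real and \<open>\<ge> 1\<close>, so
  taking the real part changes nothing, and \<open>ln\<close> is the real logarithm. For real \<open>x > 0\<close> the principal
  power \<open>of_real x powr a\<close> is \<open>exp (a * of_real (ln x))\<close>. The values at the two endpoints
  \<open>w = 0\<close> and \<open>w = z\<close> are irrelevant for the integral.\<close>

definition log_polylog_Gamma_integrand :: "complex \<Rightarrow> complex \<Rightarrow> complex \<Rightarrow> complex" where
  "log_polylog_Gamma_integrand s z w =
     ln_Gamma_quot w * complex_of_real (ln (Re (z / w))) powr (s - 2)"

end

theory Submission
  imports Defs
begin

text \<open>On the segment \<open>w = t z\<close> the right-hand side becomes
  \<open>z / \<Gamma>(s - 1) \<integral>\<^sub>0\<^sup>1 q(t z) K(t) dt\<close>, where \<open>q\<close> is the quotient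
  \<open>(log \<Gamma>(1 - w) - \<gamma> w) / w\<close> and the kernel \<open>K(t) = (log (1 / t))\<^bsup>s - 2\<^esup>\<close> is absolutely
  integrable for \<open>Re s > 1\<close>. Differentiating under the integral sign makes it holomorphic on the
  slit plane, which is star-shaped about \<open>0\<close>. For \<open>\<bar>z\<bar> < 1\<close> one expands \<open>q\<close> in its Taylor series
  \<open>\<Sum> \<zeta>(r) w\<^bsup>r - 1\<^esup> / r\<close> and integrates termwise; the substitution \<open>u = - r log t\<close> turns the moment
  \<open>\<integral>\<^sub>0\<^sup>1 t\<^bsup>r - 1\<^esup> K(t) dt\<close> into Euler's integral, with value \<open>\<Gamma>(s - 1) / r\<^bsup>s - 1\<^esup>\<close>.\<close>

section \<open>Moments of the logarithmic kernel\<close>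

lemma Gamma_log_integral:
  fixes z :: complex and a :: real
  assumes "Re z > 0" "a > 0"
  defines "f \<equiv> \<lambda>t::real. complex_of_real (t powr (a - 1)) * complex_of_real (ln (1 / t)) powr (z - 1)"
  shows "f absolutely_integrable_on {0..1}"
    and "integral {0..1} f = Gamma z / complex_of_real a powr z"
proof -
  let ?h = "\<lambda>u::real. complex_of_real u powr (z - 1) / of_real (exp u)"
  let ?g = "\<lambda>t::real. - a * ln t"
  have img: "?g ` {0<..<1} = {0<..}"
  proof (intro set_eqI iffI)
    fix u :: real assume "u \<in> {0<..}"
    hence "u = ?g (exp (- u / a))" "exp (- u / a) \<in> {0<..<1}"
      using assms(2) by auto
    thus "u \<in> ?g ` {0<..<1}" by blast
  qed (use assms(2) in \<open>auto simp: mult_pos_neg\<close>)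
  \<comment> \<open>Integrability and value are kept in one conjunction because the change of
    variables transfers both at once, as an equivalence.\<close>
  have "?h absolutely_integrable_on (?g ` {0<..<1}) \<and> integral (?g ` {0<..<1}) ?h = Gamma z"
    unfolding img using assms(1) absolutely_integrable_Gamma_integral' Gamma_integral_complex'
    by (auto simp: has_integral_iff)
  moreover have "inj_on ?g {0<..<1}"
    using assms(2) by (auto simp: inj_on_def)
  ultimately have *: "(\<lambda>t. \<bar>- a / t\<bar> *\<^sub>R ?h (?g t)) absolutely_integrable_on {0<..<1} \<and>
      integral {0<..<1} (\<lambda>t. \<bar>- a / t\<bar> *\<^sub>R ?h (?g t)) = Gamma z"
    by (subst has_absolute_integral_change_of_variables_real)
       (auto intro!: derivative_eq_intros)
  \<comment> \<open>With \<open>u = - a * ln t\<close>, the Jacobian \<open>a / t\<close> and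
    \<open>exp (- u) = t powr a\<close> combine to \<open>a * t powr (a - 1)\<close>. Since
    \<open>a\<close> and \<open>ln (1 / t)\<close> are positive reals, the principal power of their
    product splits without a branch correction.\<close>
  have eq: "\<bar>- a / t\<bar> *\<^sub>R ?h (?g t) = complex_of_real a powr z * f t" if "t \<in> {0<..<1}" for t
  proof -
    have t: "0 < t" "t < 1" using that by auto
    have L: "ln (1 / t) > 0" using t by (simp add: ln_div)
    have A: "complex_of_real (?g t) powr (z - 1)
        = complex_of_real a powr (z - 1) * complex_of_real (ln (1 / t)) powr (z - 1)"
      using assms(2) L t by (subst powr_times_real [symmetric]) (auto simp: ln_div)
    have B: "complex_of_real a powr z = complex_of_real a powr (z - 1) * complex_of_real a"
      using assms(2) by (simp add: powr_diff)
    have "1 / exp (?g t) = t powr (a - 1) * t"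
      using t by (simp add: powr_def exp_minus field_simps flip: exp_add) (simp add: algebra_simps exp_diff)
    hence "\<bar>- a / t\<bar> / exp (?g t) = a * t powr (a - 1)"
      using t assms(2) by (simp add: field_simps)
    hence C: "complex_of_real \<bar>- a / t\<bar> / of_real (exp (?g t)) = of_real a * of_real (t powr (a - 1))"
      by (metis of_real_divide of_real_mult)
    have "\<bar>- a / t\<bar> *\<^sub>R ?h (?g t)
        = complex_of_real \<bar>- a / t\<bar> / of_real (exp (?g t)) * complex_of_real (?g t) powr (z - 1)"
      by (simp only: scaleR_conv_of_real times_divide_eq_right times_divide_eq_left)
    also have "\<dots> = complex_of_real a powr z * f t"
      unfolding A B C f_def by (simp only: mult_ac)
    finally show ?thesis .
  qed
  have cnz: "complex_of_real a powr z \<noteq> 0" using assms(2) by simp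
  have 1: "(\<lambda>t. complex_of_real a powr z * f t) absolutely_integrable_on {0<..<1}"
    using * eq by (subst set_integrable_cong[OF refl refl eq[symmetric]]) auto
  have 2: "integral {0<..<1} (\<lambda>t. complex_of_real a powr z * f t) = Gamma z"
    using * eq by (subst Henstock_Kurzweil_Integration.integral_cong[OF eq[symmetric]]) auto
  have "f absolutely_integrable_on {0<..<1}"
    using 1 cnz by simp
  thus "f absolutely_integrable_on {0..1}"
    by (simp add: absolutely_integrable_on_Icc_iff_Ioo)
  show "integral {0..1} f = Gamma z / complex_of_real a powr z"
    using 2 cnz by (simp add: integral_open_interval_real field_simps)
qed

section \<open>Integrals of dilations against an integrable kernel\<close>

text \<open>\<open>Q\<close> is bounded on the compact segment, so the integrand is a bounded
  measurable function times an absolutely integrable one.\<close>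

lemma integrable_dilation_weight:
  fixes Q :: "complex \<Rightarrow> complex" and K :: "real \<Rightarrow> complex"
  assumes "continuous_on (closed_segment 0 z) Q" "K absolutely_integrable_on {0..1}"
  shows "(\<lambda>t. Q (of_real t * z) * K t) absolutely_integrable_on {0..1}"
proof -
  have cont: "continuous_on {0..1} (\<lambda>t. Q (of_real t * z))"
    by (rule continuous_on_compose2[OF assms(1)])
       (auto intro!: continuous_intros simp: closed_segment_def scaleR_conv_of_real)
  show ?thesis
    using absolutely_integrable_bounded_measurable_product[OF bilinear_times
        continuous_imp_measurable_on_sets_lebesgue[OF cont] _ _ assms(2)]
      compact_imp_bounded[OF compact_continuous_image[OF cont]]
    by auto
qed

text \<open>The kernel may be singular at the endpoints, so the derivative is passed under the
  integral by dominated convergence: the difference quotients of \<open>Q\<close> are bounded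
  uniformly in \<open>t\<close>, which gives a majorant \<open>B * norm (K t)\<close>.\<close>

lemma holomorphic_on_dilation_integral:
  fixes Q :: "complex \<Rightarrow> complex" and K :: "real \<Rightarrow> complex"
  assumes S: "open S" and star: "\<And>z t. z \<in> S \<Longrightarrow> t \<in> {0..1} \<Longrightarrow> of_real t * z \<in> S"
    and Q: "Q holomorphic_on S" and K: "K absolutely_integrable_on {0..1}"
  shows "(\<lambda>z. integral {0..1} (\<lambda>t. Q (of_real t * z) * K t)) holomorphic_on S"
proof -
  let ?F = "\<lambda>z. integral {0..1} (\<lambda>t. Q (of_real t * z) * K t)"
  have int: "(\<lambda>t. Q (of_real t * z) * K t) integrable_on {0..1}" if "z \<in> S" for z
  proof -
    have "closed_segment 0 z \<subseteq> S"
      using star[OF that] by (auto simp: closed_segment_def scaleR_conv_of_real)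
    hence "continuous_on (closed_segment 0 z) Q"
      using Q holomorphic_on_imp_continuous_on continuous_on_subset by blast
    thus ?thesis
      using integrable_dilation_weight[OF _ K] set_lebesgue_integral_eq_integral(1) by blast
  qed
  have "\<exists>D. (?F has_field_derivative D) (at z)" if z: "z \<in> S" for z
  proof -
    obtain r where r: "r > 0" "cball z r \<subseteq> S"
      using S z open_contains_cball by blast
    \<comment> \<open>\<open>C\<close> collects all dilates of the closed ball. It is compact and
      lies in \<open>S\<close> by \<open>star\<close>, so a single bound \<open>B\<close> for
      \<open>deriv Q\<close> serves all \<open>t\<close> and all nearby \<open>w\<close>.\<close>
    define C where "C = (\<lambda>(t, w). complex_of_real t * w) ` ({0..1} \<times> cball z r)"
    have "compact C"
      unfolding C_def case_prod_unfold
      by (intro compact_continuous_image continuous_intros compact_Times) auto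
    moreover have CS: "C \<subseteq> S"
      using star r by (auto simp: C_def)
    moreover have "continuous_on S (deriv Q)"
      by (intro holomorphic_on_imp_continuous_on holomorphic_deriv Q S)
    ultimately have "bounded (deriv Q ` C)"
      by (meson compact_continuous_image compact_imp_bounded continuous_on_subset)
    then obtain B where B: "\<And>w. w \<in> C \<Longrightarrow> norm (deriv Q w) \<le> B"
      by (auto simp: bounded_iff)
    have memC: "of_real t * w \<in> C" if "t \<in> {0..1}" "w \<in> cball z r" for t w
      using that by (auto simp: C_def)
    have der: "((\<lambda>w. Q (of_real t * w)) has_field_derivative of_real t * deriv Q (of_real t * w)) (at w)"
      if "t \<in> {0..1}" "w \<in> cball z r" for t w
    proof -
      have "of_real t * w \<in> S" using memC[OF that] CS by blast
      hence "(Q has_field_derivative deriv Q (of_real t * w)) (at (of_real t * w))"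
        using Q S by (rule holomorphic_derivI[rotated 2])
      hence "((\<lambda>w. Q (of_real t * w)) has_field_derivative deriv Q (of_real t * w) * of_real t) (at w)"
        by (rule DERIV_chain2) (auto intro!: derivative_eq_intros)
      thus ?thesis by (simp add: mult.commute)
    qed
    \<comment> \<open>Mean value inequality on the convex ball; the inner derivative
      \<open>t\<close> is at most 1, so the Lipschitz constant does not depend on
      \<open>t\<close>.\<close>
    have lip: "norm (Q (of_real t * w) - Q (of_real t * z)) \<le> B * norm (w - z)"
      if t: "t \<in> {0..1}" and w: "w \<in> cball z r" for t w
    proof (rule field_differentiable_bound[OF convex_cball])
      fix v assume v: "v \<in> cball z r"
      show "((\<lambda>w. Q (of_real t * w)) has_field_derivative of_real t * deriv Q (of_real t * v)) (at v within cball z r)"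
        by (rule has_field_derivative_at_within[OF der[OF t v]])
      have "\<bar>t\<bar> * norm (deriv Q (of_real t * v)) \<le> 1 * B"
        using t B[OF memC[OF t v]] by (intro mult_mono) auto
      thus "norm (of_real t * deriv Q (of_real t * v)) \<le> B" by (simp add: norm_mult)
    qed (use w r in auto)
    let ?D = "integral {0..1} (\<lambda>t. of_real t * deriv Q (of_real t * z) * K t)"
    \<comment> \<open>Dominated convergence handles sequences, so the limit is tested along
      arbitrary sequences. Keeping them in the ball makes \<open>lip\<close> available; the ball is
      open, so the limit is the unrestricted one.\<close>
    have "((\<lambda>w. (?F w - ?F z) / (w - z)) \<longlongrightarrow> ?D) (at z within ball z r)"
      unfolding tendsto_at_iff_sequentially
    proof (intro allI impI)
      fix X :: "nat \<Rightarrow> complex"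
      assume X: "\<forall>i. X i \<in> ball z r - {z}" "X \<longlonglongrightarrow> z"
      have Xc: "X k \<in> cball z r" "X k \<noteq> z" "X k \<in> S" for k
        using X(1) r by (auto simp: subset_iff dest: spec[of _ k])
      let ?f = "\<lambda>k t. (Q (of_real t * X k) * K t - Q (of_real t * z) * K t) / (X k - z)"
      have "(\<lambda>k. integral {0..1} (?f k)) \<longlonglongrightarrow> ?D"
      proof (rule dominated_convergence(2)[where h = "\<lambda>t. B * norm (K t)"])
        show "?f k integrable_on {0..1}" for k
          by (intro integrable_on_divide integrable_diff int Xc z)
        show "(\<lambda>t. B * norm (K t)) integrable_on {0..1}"
          using K by (intro integrable_on_mult_right) (auto simp: absolutely_integrable_on_def)
        show "norm (?f k t) \<le> B * norm (K t)" if "t \<in> {0..1}" for k t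
        proof -
          have "norm (?f k t) = norm (Q (of_real t * X k) - Q (of_real t * z)) * norm (K t) / norm (X k - z)"
            by (simp add: norm_divide norm_mult flip: left_diff_distrib)
          also have "\<dots> \<le> B * norm (X k - z) * norm (K t) / norm (X k - z)"
            by (intro divide_right_mono mult_right_mono lip that Xc) auto
          also have "\<dots> = B * norm (K t)" using Xc(2) by simp
          finally show ?thesis .
        qed
        show "(\<lambda>k. ?f k t) \<longlonglongrightarrow> of_real t * deriv Q (of_real t * z) * K t" if t: "t \<in> {0..1}" for t
        proof -
          have "((\<lambda>w. (Q (of_real t * w) - Q (of_real t * z)) / (w - z)) \<longlongrightarrow> of_real t * deriv Q (of_real t * z)) (at z)"
            using der[OF t, of z] r by (simp add: has_field_derivative_iff)
          hence "(\<lambda>k. (Q (of_real t * X k) - Q (of_real t * z)) / (X k - z)) \<longlonglongrightarrow> of_real t * deriv Q (of_real t * z)"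
            using X Xc(2) by (auto simp: tendsto_at_iff_sequentially o_def)
          from tendsto_mult_right[OF this, of "K t"] show ?thesis
            by (simp add: diff_divide_distrib left_diff_distrib)
        qed
      qed
      moreover have "integral {0..1} (?f k) = (?F (X k) - ?F z) / (X k - z)" for k
        by (simp add: int Xc z integral_divide Henstock_Kurzweil_Integration.integral_diff)
      ultimately show "((\<lambda>w. (?F w - ?F z) / (w - z)) \<circ> X) \<longlonglongrightarrow> ?D"
        by (simp only: o_def)
    qed
    moreover have "at z within ball z r = at z"
      using r by (intro at_within_open) auto
    ultimately show ?thesis
      by (auto simp: has_field_derivative_iff)
  qed
  thus ?thesis
    using S by (auto simp: holomorphic_on_open)
qed

text \<open>Since \<open>t\<close> is at most 1, all partial sums are dominated by the absolutely
  convergent series at \<open>z\<close> times \<open>norm (K t)\<close>, which permits termwise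
  integration.\<close>

lemma sums_dilation_integral:
  fixes Q :: "complex \<Rightarrow> complex" and K :: "real \<Rightarrow> complex"
  assumes Q: "\<And>w. norm w < R \<Longrightarrow> (\<lambda>n. c n * w ^ n) sums Q w"
    and K: "K absolutely_integrable_on {0..1}" and z: "norm z < R"
  shows "(\<lambda>n. c n * z ^ n * integral {0..1} (\<lambda>t. of_real (t ^ n) * K t))
           sums integral {0..1} (\<lambda>t. Q (of_real t * z) * K t)"
proof -
  \<comment> \<open>Convergence at a point of modulus \<open>r\<close> strictly larger than
    \<open>norm z\<close> yields absolute convergence at \<open>z\<close>.\<close>
  obtain r where r: "norm z < r" "r < R" using z dense by blast
  have "summable (\<lambda>n. c n * of_real r ^ n)"
    using Q[of "of_real r"] r le_less_trans[OF norm_ge_zero r(1)] by (simp add: sums_iff)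
  hence sn: "summable (\<lambda>n. norm (c n * z ^ n))"
    by (rule powser_insidea) (use r in auto)
  have int: "(\<lambda>t. of_real (t ^ n) * K t) integrable_on {0..1}" for n
    using integrable_dilation_weight[of 1 "\<lambda>w. w ^ n", OF _ K] set_lebesgue_integral_eq_integral(1)
    by (fastforce intro!: continuous_intros)
  let ?f = "\<lambda>N t. \<Sum>n<N. c n * z ^ n * (of_real (t ^ n) * K t)"
  have "(\<lambda>N. integral {0..1} (?f N)) \<longlonglongrightarrow> integral {0..1} (\<lambda>t. Q (of_real t * z) * K t)"
  proof (rule dominated_convergence(2)[where h = "\<lambda>t. (\<Sum>n. norm (c n * z ^ n)) * norm (K t)"])
    show "?f N integrable_on {0..1}" for N
      by (intro integrable_sum integrable_on_mult_right int) auto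
    show "(\<lambda>t. (\<Sum>n. norm (c n * z ^ n)) * norm (K t)) integrable_on {0..1}"
      using K by (intro integrable_on_mult_right) (auto simp: absolutely_integrable_on_def)
    fix t :: real assume t: "t \<in> {0..1}"
    show "norm (?f N t) \<le> (\<Sum>n. norm (c n * z ^ n)) * norm (K t)" for N
    proof -
      have "norm (?f N t) \<le> (\<Sum>n<N. norm (c n * z ^ n) * norm (K t))"
      proof (rule sum_norm_le)
        fix n
        have "t ^ n * norm (K t) \<le> norm (K t)"
          using t by (intro mult_left_le_one_le) (auto intro: power_le_one)
        thus "norm (c n * z ^ n * (of_real (t ^ n) * K t)) \<le> norm (c n * z ^ n) * norm (K t)"
          using t by (simp add: norm_mult norm_power mult_left_mono)
      qed
      also have "\<dots> \<le> (\<Sum>n. norm (c n * z ^ n)) * norm (K t)"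
        unfolding sum_distrib_right[symmetric]
        by (intro mult_right_mono sum_le_suminf sn) auto
      finally show ?thesis .
    qed
    have "norm (of_real t * z) < R"
    proof -
      have "\<bar>t\<bar> * norm z \<le> 1 * norm z" using t by (intro mult_right_mono) auto
      thus ?thesis using z by (simp add: norm_mult)
    qed
    from sums_mult2[OF Q[OF this], of "K t"]
    show "(\<lambda>N. ?f N t) \<longlonglongrightarrow> Q (of_real t * z) * K t"
      by (simp add: sums_def power_mult_distrib mult_ac)
  qed
  moreover have "integral {0..1} (?f N)
      = (\<Sum>n<N. c n * z ^ n * integral {0..1} (\<lambda>t. of_real (t ^ n) * K t))" for N
    by (subst Henstock_Kurzweil_Integration.integral_sum)
       (auto intro!: integrable_on_mult_right int[unfolded of_real_power])
  ultimately show ?thesis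
    by (simp add: sums_def)
qed

section \<open>The slit plane and the Taylor series of the quotient\<close>

lemma ball_subset_slit_plane: "ball 0 1 \<subseteq> slit_plane"
  by (auto simp: slit_plane_def)

text \<open>Star-shapedness about 0, in the form used for dilation integrals: dividing a real number
  \<open>x \<ge> 1\<close> by \<open>t\<close> in \<open>(0, 1]\<close> leaves it on the removed
  ray.\<close>

lemma of_real_mult_in_slit_plane:
  assumes "z \<in> slit_plane" "t \<in> {0..1}"
  shows "of_real t * z \<in> slit_plane"
proof (rule ccontr)
  assume "of_real t * z \<notin> slit_plane"
  then obtain x where x: "x \<ge> 1" "of_real t * z = of_real x"
    by (auto simp: slit_plane_def)
  hence "t > 0" using assms(2) by (cases "t = 0") auto
  hence "z = of_real (x / t)" "x / t \<ge> 1"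
    using x assms(2) by (auto simp: field_simps)
  thus False using assms(1) unfolding slit_plane_def by blast
qed

text \<open>For \<open>n > 0\<close> the polygamma function is given by its series in inverse powers
  of \<open>z + k\<close>, which at \<open>z = 1\<close> becomes the Dirichlet series of
  \<open>zeta\<close>. The case \<open>n = 0\<close> is the Digamma function instead.\<close>

lemma Polygamma_1_zeta:
  assumes "n > 0"
  shows "Polygamma n (1 :: complex) = (-1) ^ Suc n * fact n * zeta (of_nat (Suc n))"
proof -
  have "1 / of_nat (Suc k) powr of_nat (Suc n) = inverse ((1 + of_nat k :: complex) ^ Suc n)" for k
    by (subst powr_nat) (auto simp: field_simps simp del: of_nat_Suc power_Suc, auto)
  thus ?thesis
    using assms by (simp add: Polygamma_def zeta_def)
qed

lemma higher_deriv_ln_Gamma_one_minus: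
  assumes "w \<in> slit_plane"
  shows "(deriv ^^ Suc n) (\<lambda>w. ln_Gamma (1 - w)) w = (-1) ^ Suc n * Polygamma n (1 - w :: complex)"
  using assms
proof (induction n arbitrary: w)
  case 0
  have "((\<lambda>w. ln_Gamma (1 - w)) has_field_derivative (- Digamma (1 - w))) (at w)"
    using one_minus_slit_plane[OF 0] by (auto intro!: derivative_eq_intros)
  thus ?case by (simp add: DERIV_imp_deriv)
next
  case (Suc n)
  have nz: "1 - w \<notin> \<int>\<^sub>\<le>\<^sub>0"
    using one_minus_slit_plane[OF Suc.prems] nonpos_Ints_subset_nonpos_Reals by blast
  \<comment> \<open>Differentiating the induction hypothesis requires it on a whole neighbourhood of
    \<open>w\<close>, which openness of the slit plane supplies.\<close>
  have "eventually (\<lambda>v. v \<in> slit_plane) (nhds w)"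
    using Suc.prems open_slit_plane eventually_nhds_in_open by blast
  hence "eventually (\<lambda>v. (deriv ^^ Suc n) (\<lambda>w. ln_Gamma (1 - w)) v
           = (-1) ^ Suc n * Polygamma n (1 - v :: complex)) (nhds w)"
    by eventually_elim (rule Suc.IH)
  hence "deriv ((deriv ^^ Suc n) (\<lambda>w. ln_Gamma (1 - w))) w
      = deriv (\<lambda>v. (-1) ^ Suc n * Polygamma n (1 - v :: complex)) w"
    by (rule deriv_cong_ev) simp
  also have "\<dots> = (-1) ^ Suc (Suc n) * Polygamma (Suc n) (1 - w)"
    using nz by (intro DERIV_imp_deriv) (auto intro!: derivative_eq_intros)
  finally show ?case by simp
qed

text \<open>The Taylor coefficients of \<open>ln_Gamma (1 - w)\<close> at 0 are
  \<open>\<gamma>\<close> in degree 1 and \<open>zeta r / r\<close> in degree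
  \<open>r \<ge> 2\<close>. Subtracting \<open>\<gamma> w\<close> removes the linear term, and
  division by \<open>w\<close> lowers each degree by one.\<close>

lemma ln_Gamma_quot_sums:
  assumes w: "norm w < 1"
  shows "(\<lambda>n. (if n = 0 then 0 else zeta (of_nat (Suc n)) / of_nat (Suc n)) * w ^ n) sums ln_Gamma_quot w"
proof (cases "w = 0")
  case True
  have "(\<lambda>n. (if n = 0 then 0 else zeta (of_nat (Suc n)) / of_nat (Suc n)) * w ^ n) = (\<lambda>n. 0)"
    by (auto simp: True)
  thus ?thesis by (simp add: True ln_Gamma_quot_def)
next
  case False
  let ?L = "\<lambda>w::complex. ln_Gamma (1 - w)"
  have "?L holomorphic_on ball 0 1"
    using holomorphic_ln_Gamma_one_minus ball_subset_slit_plane holomorphic_on_subset by blast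
  from holomorphic_power_series[OF this, of w] w
  have "(\<lambda>n. (deriv ^^ n) ?L 0 / fact n * w ^ n) sums ?L w" by simp
  \<comment> \<open>The constant term \<open>ln_Gamma 1\<close> is 0, so the series may start in
    degree 1.\<close>
  hence "(\<lambda>n. (deriv ^^ Suc n) ?L 0 / fact (Suc n) * w ^ Suc n) sums ?L w"
    by (subst sums_Suc_iff) (simp add: ln_Gamma_complex_1)
  moreover have "(\<lambda>n. if n = 0 then euler_mascheroni * w else 0) sums (euler_mascheroni * w)"
    using sums_single[of 0 "\<lambda>_. euler_mascheroni * w"] by simp
  ultimately have "(\<lambda>n. ((deriv ^^ Suc n) ?L 0 / fact (Suc n) * w ^ Suc n
      - (if n = 0 then euler_mascheroni * w else 0)) / w) sums ((?L w - euler_mascheroni * w) / w)"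
    by (intro sums_divide sums_diff)
  moreover have "((deriv ^^ Suc n) ?L 0 / fact (Suc n) * w ^ Suc n
      - (if n = 0 then euler_mascheroni * w else 0)) / w
      = (if n = 0 then 0 else zeta (of_nat (Suc n)) / of_nat (Suc n)) * w ^ n" for n
  proof -
    have "0 \<in> slit_plane" using ball_subset_slit_plane by auto
    note d = higher_deriv_ln_Gamma_one_minus[OF this, of n]
    show ?thesis
    proof (cases "n = 0")
      case True
      thus ?thesis using d by simp
    next
      case n: False
      \<comment> \<open>The sign from repeated differentiation of \<open>1 - w\<close> cancels the
        sign in the polygamma value.\<close>
      have "(deriv ^^ Suc n) ?L 0 = fact n * zeta (of_nat (Suc n))"
        using n unfolding d by (simp add: Polygamma_1_zeta del: of_nat_Suc flip: power_add mult.assoc power_mult_distrib)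
      thus ?thesis using n False
        by (simp add: field_simps del: funpow.simps of_nat_Suc)
    qed
  qed
  ultimately show ?thesis
    using False by (simp only: ln_Gamma_quot_def if_False)
qed

text \<open>Both sides also agree at \<open>t = 0\<close>, where division by zero makes both kernels \<open>0\<close>.\<close>

lemma integrand_linepath:
  "log_polylog_Gamma_integrand s z (linepath 0 z t) * (z - 0)
     = z * (ln_Gamma_quot (of_real t * z) * complex_of_real (ln (1 / t)) powr (s - 2))"
proof (cases "z = 0")
  case False
  hence "z / (of_real t * z) = of_real (1 / t)" by simp
  hence "Re (z / (of_real t * z)) = 1 / t" by (metis Re_complex_of_real)
  thus ?thesis
    by (simp add: log_polylog_Gamma_integrand_def linepath_def scaleR_conv_of_real)
qed simp

section \<open>The extension and its integral representation\<close>

theorem theorem3p3: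
  fixes s :: complex
  assumes "Re s > 1"
  shows "\<exists>F. F holomorphic_on slit_plane \<and>
             (\<forall>z. norm z < 1 \<longrightarrow>
                (\<lambda>k. zeta (of_nat (k + 2)) / of_nat (k + 2) powr s * z ^ (k + 2)) sums F z \<and>
                F z = log_polylog_Gamma s z) \<and>
             (\<forall>z\<in>slit_plane.
                log_polylog_Gamma_integrand s z contour_integrable_on linepath 0 z \<and>
                F z = 1 / Gamma (s - 1) *
                      contour_integral (linepath 0 z) (log_polylog_Gamma_integrand s z))"
proof -
  define K where "K = (\<lambda>t::real. complex_of_real (ln (1 / t)) powr (s - 2))"
  define I where "I = (\<lambda>z. integral {0..1} (\<lambda>t. ln_Gamma_quot (of_real t * z) * K t))"
  \<comment> \<open>\<open>F\<close> is the right-hand side after substituting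
    \<open>w = t z\<close>, so the extension satisfies the integral formula by construction; the
    remaining task is to match its power series on the unit disc.\<close>
  define F where "F = (\<lambda>z. 1 / Gamma (s - 1) * (z * I z))"
  have moment: "(\<lambda>t. of_real (t ^ n) * K t) absolutely_integrable_on {0..1}"
    "integral {0..1} (\<lambda>t. of_real (t ^ n) * K t) = Gamma (s - 1) / of_nat (Suc n) powr (s - 1)" for n
  proof -
    let ?f = "\<lambda>t. complex_of_real (t powr (real (Suc n) - 1)) * complex_of_real (ln (1 / t)) powr (s - 1 - 1)"
    \<comment> \<open>At \<open>t = 0\<close> and \<open>n = 0\<close> the conventions
      \<open>0 ^ 0 = 1\<close> and \<open>0 powr 0 = 0\<close> differ, but \<open>K 0 = 0\<close>
      makes both sides vanish.\<close>
    have eq: "of_real (t ^ n) * K t = ?f t" if "t \<in> {0..1}" for t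
      using that by (cases "t = 0") (auto simp: K_def powr_realpow)
    have *: "?f absolutely_integrable_on {0..1}"
      "integral {0..1} ?f = Gamma (s - 1) / of_nat (Suc n) powr (s - 1)"
      using Gamma_log_integral[of "s - 1" "real (Suc n)"] assms by (auto simp del: of_nat_Suc)
    show "(\<lambda>t. of_real (t ^ n) * K t) absolutely_integrable_on {0..1}"
      using *(1) by (subst set_integrable_cong[OF refl refl eq]) auto
    show "integral {0..1} (\<lambda>t. of_real (t ^ n) * K t) = Gamma (s - 1) / of_nat (Suc n) powr (s - 1)"
      using *(2) by (subst Henstock_Kurzweil_Integration.integral_cong[OF eq]) auto
  qed
  have K: "K absolutely_integrable_on {0..1}" using moment(1)[of 0] by simp
  \<comment> \<open>\<open>Gamma\<close> takes the value 0 only at its poles, by convention;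
    \<open>Re (s - 1) > 0\<close> excludes them.\<close>
  have "Gamma (s - 1) \<noteq> 0"
    using assms by (auto simp: Gamma_eq_zero_iff elim!: nonpos_Ints_cases dest: arg_cong[of _ _ Re])
  have "I holomorphic_on slit_plane"
    unfolding I_def
    by (rule holomorphic_on_dilation_integral[OF open_slit_plane of_real_mult_in_slit_plane
          holomorphic_ln_Gamma_quot K])
  hence "F holomorphic_on slit_plane"
    unfolding F_def by (intro holomorphic_intros)
  moreover have sums: "(\<lambda>k. zeta (of_nat (k + 2)) / of_nat (k + 2) powr s * z ^ (k + 2)) sums F z"
    if z: "norm z < 1" for z
  proof -
    let ?c = "\<lambda>n. if n = 0 then 0 else zeta (of_nat (Suc n)) / of_nat (Suc n)"
    let ?a = "\<lambda>n. ?c n * z ^ n * integral {0..1} (\<lambda>t. of_real (t ^ n) * K t)"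
    have "?a sums I z"
      unfolding I_def by (rule sums_dilation_integral[OF ln_Gamma_quot_sums K z])
    \<comment> \<open>The coefficient in degree 0 vanishes, so the index shifts by one; the factor
      \<open>z\<close> in \<open>F\<close> supplies the second shift, to
      \<open>r = n + 2\<close>.\<close>
    hence "(\<lambda>n. ?a (Suc n)) sums I z"
      by (subst sums_Suc_iff) simp
    hence "(\<lambda>n. 1 / Gamma (s - 1) * (z * ?a (Suc n))) sums F z"
      unfolding F_def by (intro sums_mult)
    \<comment> \<open>The Taylor coefficient contributes \<open>1 / r\<close> and the moment
      contributes \<open>Gamma (s - 1) / r powr (s - 1)\<close>; together they give
      \<open>1 / r powr s\<close> once the Gamma factor cancels.\<close>
    moreover have "1 / Gamma (s - 1) * (z * ?a (Suc n))
        = zeta (of_nat (n + 2)) / of_nat (n + 2) powr s * z ^ (n + 2)" for n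
    proof -
      have "complex_of_nat (n + 2) powr s = of_nat (n + 2) * of_nat (n + 2) powr (s - 1)"
        by (simp add: powr_diff del: of_nat_add of_nat_Suc)
      thus ?thesis
        using \<open>Gamma (s - 1) \<noteq> 0\<close> unfolding moment(2)
        by (simp add: field_simps del: of_nat_Suc of_nat_add)
    qed
    ultimately show ?thesis by simp
  qed
  moreover have "(log_polylog_Gamma_integrand s z has_contour_integral z * I z) (linepath 0 z)"
    if z: "z \<in> slit_plane" for z
  proof -
    have "closed_segment 0 z \<subseteq> slit_plane"
      using of_real_mult_in_slit_plane[OF z] by (auto simp: closed_segment_def scaleR_conv_of_real)
    hence "continuous_on (closed_segment 0 z) ln_Gamma_quot"
      using holomorphic_ln_Gamma_quot holomorphic_on_imp_continuous_on continuous_on_subset by blast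
    from integrable_dilation_weight[OF this K]
    have "((\<lambda>t. ln_Gamma_quot (of_real t * z) * K t) has_integral I z) {0..1}"
      unfolding I_def using set_lebesgue_integral_eq_integral(1) by blast
    from has_integral_mult_right[OF this, of z] show ?thesis
      unfolding has_contour_integral_linepath integrand_linepath K_def .
  qed
  hence "\<forall>z\<in>slit_plane. log_polylog_Gamma_integrand s z contour_integrable_on linepath 0 z \<and>
      F z = 1 / Gamma (s - 1) * contour_integral (linepath 0 z) (log_polylog_Gamma_integrand s z)"
    unfolding F_def using contour_integral_unique contour_integrable_on_def by metis
  ultimately show ?thesis
    unfolding log_polylog_Gamma_def by (intro exI[of _ F]) (auto simp: sums_iff)
qed

end
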